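(* (Path Lifting Property) Let $(X,x_0)$ be a graph with distinguished vertex $x_0$ and let $(\widetilde{X},\rho)$ be a covering graph of $X$. For each stable graph homomorphism $f: I_\infty \to X$ with $f(n_f^1)=x_0$ and each vertex $\widetilde{x}_0 \in \rho^{-1}(x_0)$, there exists a unique lift $\widetilde{f}: I_\infty \to \widetilde{X}$ of $f$ starting at the vertex $\widetilde{x}_0$.
   Context: Graphs: every graph $X$ is a simple graph (possibly infinite) with a loop attached at every vertex, with vertex set $V(X)$ and edge set $E(X)$; $v,w$ are adjacent if $vw\in E(X)$, so every vertex is adjacent to itself. A graph homomorphism $f:X\to Y$ is a map $V(X)\to V(Y)$ with $f(u)f(v)\in E(Y)$ whenever $uv\in E(X)$. Paths: $I_\infty$ is the graph with vertex set $\mathbb{Z}$ in which $i$ and $j$ are adjacent iff $|i-j|\le 1$. A graph homomorphism $f:I_\infty\to X$ is stable if there are integers $p,n$ such that $f(m)=f(p)$ for all $m\ge p$ and $f(m)=f(n)$ for all $m\le n$; $p_f^1$ denotes the least such $p$ and $n_f^1$ the greatest such $n$ (if $f$ is constant, $p_f^1=n_f^1=0$ by convention). A graph homomorphism $f: I_\infty\to X$ starts at the vertex $f(n_f^1)$ and ends at the vertex $f(p_f^1)$ when these integers exist. Coverings: for $x\in V(X)$ the closed neighborhood is $N[x]=\{v\in V(X) : vx\in E(X)\}$. A graph homomorphism $\rho:X\to Y$ is a local isomorphism if for each $y\in V(Y)$ and each $x\in\rho^{-1}(y)$ the restriction $\rho|_{N[x]}:N[x]\to N[y]$ is bijective. A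 pair $(\widetilde{X},\rho)$ with $\rho:\widetilde{X}\to X$ a graph homomorphism is a covering graph of $X$ if $\rho$ is a surjective local isomorphism. Given a covering graph $(\widetilde X,\rho)$ of $X$ and a graph homomorphism $f:Y\to X$, a lift of $f$ is a graph homomorphism $\widetilde f:Y\to\widetilde X$ with $\rho\circ\widetilde f=f$. *)

theory Defs
  imports Main "HOL-Library.FuncSet"
begin

record 'a graph =
  verts :: "'a set"
  edges :: "('a \<times> 'a) set"

text \<open>Undirected simple graphs, possibly infinite, with a loop at every vertex. The edge set is
  encoded as a symmetric relation: the edge \<open>uv\<close> is present iff \<open>(u, v)\<close> (equivalently
  \<open>(v, u)\<close>) belongs to it.\<close>

definition looped_graph :: "'a graph \<Rightarrow> bool" where
  "looped_graph X \<longleftrightarrow>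
     edges X \<subseteq> verts X \<times> verts X \<and> sym (edges X) \<and> (\<forall>v\<in>verts X. (v, v) \<in> edges X)"

definition graph_hom :: "'a graph \<Rightarrow> 'b graph \<Rightarrow> ('a \<Rightarrow> 'b) \<Rightarrow> bool" where
  "graph_hom X Y f \<longleftrightarrow>
     f \<in> verts X \<rightarrow> verts Y \<and> (\<forall>u v. (u, v) \<in> edges X \<longrightarrow> (f u, f v) \<in> edges Y)"

definition I_inf :: "int graph" where
  "I_inf = \<lparr>verts = UNIV, edges = {(i, j). \<bar>i - j\<bar> \<le> 1}\<rparr>"

lemma looped_graph_I_inf: "looped_graph I_inf"
  by (auto simp: looped_graph_def I_inf_def sym_def)

definition left_stable :: "(int \<Rightarrow> 'a) \<Rightarrow> bool" where
  "left_stable f \<longleftrightarrow> (\<exists>n. \<forall>m\<le>n. f m = f n)"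

definition right_stable :: "(int \<Rightarrow> 'a) \<Rightarrow> bool" where
  "right_stable f \<longleftrightarrow> (\<exists>p. \<forall>m\<ge>p. f m = f p)"

definition stable_map :: "(int \<Rightarrow> 'a) \<Rightarrow> bool" where
  "stable_map f \<longleftrightarrow> left_stable f \<and> right_stable f"

text \<open>The number \<open>n\<^sub>f\<^sup>1\<close>. The greatest integer exists for every non-constant left-stable \<open>f\<close>;
  the value is unspecified if \<open>f\<close> is not left-stable.\<close>

definition start_index :: "(int \<Rightarrow> 'a) \<Rightarrow> int" where
  "start_index f =
     (if \<exists>c. \<forall>i. f i = c then 0 else (GREATEST n. \<forall>m\<le>n. f m = f n))"

definition starts_at :: "(int \<Rightarrow> 'a) \<Rightarrow> 'a \<Rightarrow> bool" where
  "starts_at f v \<longleftrightarrow> left_stable f \<and> f (start_index f) = v"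

definition closed_nbhd :: "'a graph \<Rightarrow> 'a \<Rightarrow> 'a set" where
  "closed_nbhd X x = {v \<in> verts X. (v, x) \<in> edges X}"

definition local_iso :: "'a graph \<Rightarrow> 'b graph \<Rightarrow> ('a \<Rightarrow> 'b) \<Rightarrow> bool" where
  "local_iso X Y \<rho> \<longleftrightarrow> graph_hom X Y \<rho> \<and>
     (\<forall>y\<in>verts Y. \<forall>x\<in>verts X. \<rho> x = y \<longrightarrow> bij_betw \<rho> (closed_nbhd X x) (closed_nbhd Y y))"

definition covering_graph :: "'a graph \<Rightarrow> ('a \<Rightarrow> 'b) \<Rightarrow> 'b graph \<Rightarrow> bool" where
  "covering_graph X' \<rho> X \<longleftrightarrow>
     looped_graph X' \<and> local_iso X' X \<rho> \<and> \<rho> ` verts X' = verts X"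

definition is_lift ::
  "'c graph \<Rightarrow> 'a graph \<Rightarrow> ('a \<Rightarrow> 'b) \<Rightarrow> ('c \<Rightarrow> 'b) \<Rightarrow> ('c \<Rightarrow> 'a) \<Rightarrow> bool" where
  "is_lift Y X' \<rho> f f' \<longleftrightarrow> graph_hom Y X' f' \<and> (\<forall>v\<in>verts Y. \<rho> (f' v) = f v)"

end

theory Submission imports Defs begin

text \<open>
  A homomorphism from \<open>I_inf\<close> is a two-way infinite walk, and "starting at \<open>v\<close>" means nothing more
  than being equal to \<open>v\<close> far enough to the left (\<open>starts_at_iff\<close>); this removes the index
  \<open>start_index\<close> from the problem. A covering map is a bijection on closed neighborhoods, so above
  each edge \<open>\<rho>(x) y\<close> there is exactly one edge at \<open>x\<close> (\<open>covering_edge_lift\<close>).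

  Both halves of the theorem follow by walking along \<open>f\<close> from its constant left end. For existence,
  the lift is the constant \<open>x\<^sub>0'\<close> on the left end, and each further step of \<open>f\<close> is lifted
  to the edge at the vertex reached so far. For uniqueness, two lifts starting at \<open>x\<^sub>0'\<close> agree
  far enough to the left, and lifts that agree at one integer agree at its neighbors
  (\<open>lift_unique\<close>).
\<close>

text \<open>
  If \<open>f\<close> is not constant, the integers \<open>n\<close> below which \<open>f\<close> is constant are bounded above, so the
  greatest one exists and \<open>f\<close> takes its left end value there. If \<open>f\<close> is constant, no greatest such
  \<open>n\<close> exists, but then any index serves, in particular the conventional \<open>0\<close>.
\<close>

lemma starts_at_iff: "starts_at f v \<longleftrightarrow> (\<exists>n. \<forall>m\<le>n. f m = v)"
proof -
  have start_value: "f (start_index f) = c" if n: "\<forall>m\<le>n. f m = c" for n c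
  proof (cases "\<exists>c. \<forall>i. f i = c")
    case True
    then show ?thesis using n by (metis order_refl)
  next
    case False
    then obtain k where k: "f k \<noteq> c" by blast
    define S where "S = {i \<in> {n..k}. \<forall>m\<le>i. f m = c}"
    have "n \<le> k" using n k by (meson linear)
    then have "n \<in> S" using n by (simp add: S_def)
    moreover have "finite S" by (rule finite_subset[of _ "{n..k}"]) (auto simp: S_def)
    ultimately have "Max S \<in> S" and max: "\<And>i. i \<in> S \<Longrightarrow> i \<le> Max S"
      using Max_in Max_ge by blast+
    have "f m = c" if "i \<in> S" "m \<le> i" for i m using that by (simp add: S_def)
    note left = this[OF \<open>Max S \<in> S\<close>]
    have "(GREATEST n. \<forall>m\<le>n. f m = f n) = Max S"
    proof (rule Greatest_equality)
      show "\<forall>m\<le>Max S. f m = f (Max S)" using left by simp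
    next
      fix i assume i: "\<forall>m\<le>i. f m = f i"
      have "f i = c" using i[rule_format, of "min i n"] n[rule_format, of "min i n"] by simp
      with i have below: "\<forall>m\<le>i. f m = c" by metis
      with k have "i < k" by (meson not_less)
      show "i \<le> Max S"
      proof (cases "n \<le> i")
        case True
        then have "i \<in> S" using below \<open>i < k\<close> by (simp add: S_def)
        then show ?thesis by (rule max)
      next
        case False
        then show ?thesis using max[OF \<open>n \<in> S\<close>] by simp
      qed
    qed
    then have "start_index f = Max S" unfolding start_index_def if_not_P[OF False] .
    then show ?thesis using left by simp
  qed
  show ?thesis
  proof
    assume "starts_at f v"
    then obtain n where n: "\<forall>m\<le>n. f m = f n" and start: "f (start_index f) = v"
      unfolding starts_at_def left_stable_def by blast
    have "f n = v" using start_value[OF n] start by simp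
    then show "\<exists>n. \<forall>m\<le>n. f m = v" using n by blast
  next
    assume "\<exists>n. \<forall>m\<le>n. f m = v"
    then obtain n where n: "\<forall>m\<le>n. f m = v" by blast
    then have "left_stable f" unfolding left_stable_def by (metis order_refl)
    then show "starts_at f v" using start_value[OF n] by (simp add: starts_at_def)
  qed
qed

lemma graph_hom_I_inf_iff:
  assumes "looped_graph X"
  shows "graph_hom I_inf X f \<longleftrightarrow> (\<forall>i. (f i, f (i + 1)) \<in> edges X)"
proof
  assume "graph_hom I_inf X f"
  then show "\<forall>i. (f i, f (i + 1)) \<in> edges X" by (simp add: graph_hom_def I_inf_def)
next
  assume step: "\<forall>i. (f i, f (i + 1)) \<in> edges X"
  have verts: "f i \<in> verts X" for i
    using step assms by (auto simp: looped_graph_def)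
  have "(f i, f j) \<in> edges X" if "\<bar>i - j\<bar> \<le> 1" for i j
  proof -
    from that consider "j = i" | "j = i + 1" | "i = j + 1" by linarith
    then show ?thesis
      using step verts assms by cases (auto simp: looped_graph_def dest: symD)
  qed
  then show "graph_hom I_inf X f" using verts by (auto simp: graph_hom_def I_inf_def)
qed

text \<open>
  The edges at \<open>x\<close> correspond to the vertices of \<open>N[x]\<close>, which \<open>\<rho>\<close> maps bijectively onto \<open>N[\<rho> x]\<close>.
\<close>

lemma covering_edge_lift:
  assumes "looped_graph X" and "covering_graph X' \<rho> X"
    and "x \<in> verts X'" and "(\<rho> x, y) \<in> edges X"
  shows "\<exists>!y'. (x, y') \<in> edges X' \<and> \<rho> y' = y"
proof -
  have X': "edges X' \<subseteq> verts X' \<times> verts X'" "sym (edges X')"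
    and "local_iso X' X \<rho>" and "\<rho> x \<in> verts X"
    using assms(2,3) by (auto simp: covering_graph_def looped_graph_def)
  then have bij: "bij_betw \<rho> (closed_nbhd X' x) (closed_nbhd X (\<rho> x))"
    using assms(3) by (simp add: local_iso_def)
  have nbhd: "y' \<in> closed_nbhd X' x \<longleftrightarrow> (x, y') \<in> edges X'" for y'
    using X' by (auto simp: closed_nbhd_def dest: symD)
  have "y \<in> closed_nbhd X (\<rho> x)"
    using assms(1,4) by (auto simp: closed_nbhd_def looped_graph_def dest: symD)
  then have "y \<in> \<rho> ` closed_nbhd X' x" using bij_betw_imp_surj_on[OF bij] by simp
  then obtain y' where y': "y' \<in> closed_nbhd X' x" "\<rho> y' = y" by blast
  moreover have "z = y'" if "z \<in> closed_nbhd X' x" "\<rho> z = y" for z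
    by (rule inj_onD[OF bij_betw_imp_inj_on[OF bij]]) (simp_all add: y' that)
  ultimately show ?thesis using y' unfolding nbhd by blast
qed

text \<open>
  Agreement at \<open>i\<close> spreads to \<open>i + 1\<close> and to \<open>i - 1\<close>, because both lifts continue along the one edge
  above the corresponding edge of \<open>f\<close>.
\<close>

lemma lift_unique:
  assumes X: "looped_graph X" and cov: "covering_graph X' \<rho> X"
    and f: "graph_hom I_inf X f"
    and g: "is_lift I_inf X' \<rho> f g" and h: "is_lift I_inf X' \<rho> f h"
    and agree: "g n = h n"
  shows "g = h"
proof
  fix i
  have neighbor: "g j = h j" if "g i = h i" "\<bar>i - j\<bar> \<le> 1" for i j
  proof -
    have "g i \<in> verts X'" using g by (auto simp: is_lift_def graph_hom_def I_inf_def)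
    moreover have "(\<rho> (g i), f j) \<in> edges X"
      using f g that(2) by (simp add: is_lift_def graph_hom_def I_inf_def)
    ultimately have "\<exists>!y. (g i, y) \<in> edges X' \<and> \<rho> y = f j"
      by (rule covering_edge_lift[OF X cov])
    moreover have "(g i, g j) \<in> edges X' \<and> \<rho> (g j) = f j"
      using g that(2) by (simp add: is_lift_def graph_hom_def I_inf_def)
    moreover have "(g i, h j) \<in> edges X' \<and> \<rho> (h j) = f j"
      using h that by (simp add: is_lift_def graph_hom_def I_inf_def)
    ultimately show ?thesis by blast
  qed
  show "g i = h i"
  proof (induction i rule: int_induct[where k = n])
    case base
    show ?case by (rule agree)
  next
    case (step1 i)
    show ?case by (rule neighbor[OF step1.IH]) simp
  next
    case (step2 i)
    show ?case by (rule neighbor[OF step2.IH]) simp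
  qed
qed

lemma lift_exists:
  assumes X: "looped_graph X" and cov: "covering_graph X' \<rho> X"
    and f: "graph_hom I_inf X f" and left: "\<forall>m\<le>n. f m = \<rho> x"
    and x: "x \<in> verts X'"
  shows "\<exists>g. is_lift I_inf X' \<rho> f g \<and> (\<forall>m\<le>n. g m = x)"
proof -
  have X': "looped_graph X'" using cov by (simp add: covering_graph_def)
  have "\<exists>s. \<forall>k::nat. (s k \<in> verts X' \<and> \<rho> (s k) = f (n + int k) \<and> (k = 0 \<longrightarrow> s k = x)) \<and>
          (s k, s (Suc k)) \<in> edges X'"
  proof (rule dependent_nat_choice)
    show "\<exists>y. y \<in> verts X' \<and> \<rho> y = f (n + int 0) \<and> (0 = (0::nat) \<longrightarrow> y = x)"
      using x left by simp
  next
    fix y and k :: nat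
    assume y: "y \<in> verts X' \<and> \<rho> y = f (n + int k) \<and> (k = 0 \<longrightarrow> y = x)"
    then have "(\<rho> y, f (n + int (Suc k))) \<in> edges X"
      using f by (simp add: graph_hom_def I_inf_def)
    then obtain z where "(y, z) \<in> edges X'" "\<rho> z = f (n + int (Suc k))"
      using covering_edge_lift[OF X cov] y by blast
    then show "\<exists>z. (z \<in> verts X' \<and> \<rho> z = f (n + int (Suc k)) \<and> (Suc k = 0 \<longrightarrow> z = x)) \<and>
                 (y, z) \<in> edges X'"
      using X' by (auto simp: looped_graph_def)
  qed
  then obtain s where s0: "s 0 = x" and s_lift: "\<And>k. \<rho> (s k) = f (n + int k)"
    and s_step: "\<And>k. (s k, s (Suc k)) \<in> edges X'"
    by blast
  \<comment> \<open>Truncation by \<open>nat\<close> sends every \<open>m \<le> n\<close> to \<open>0\<close> and so gives the constant left end.\<close>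
  define g where "g m = s (nat (m - n))" for m
  have "(g i, g (i + 1)) \<in> edges X'" for i
  proof (cases "n \<le> i")
    case True
    then have "nat (i + 1 - n) = Suc (nat (i - n))" by simp
    then show ?thesis using s_step by (simp add: g_def)
  next
    case False
    then show ?thesis using s0 x X' by (simp add: g_def looped_graph_def)
  qed
  moreover have "\<rho> (g i) = f i" for i
    using s_lift[of "nat (i - n)"] left by (cases "n \<le> i") (auto simp: g_def)
  moreover have "\<forall>m\<le>n. g m = x" using s0 by (simp add: g_def)
  ultimately show ?thesis
    using graph_hom_I_inf_iff[OF X'] by (auto simp: is_lift_def)
qed

theorem theorem3p0p9:
  fixes X :: "'b graph" and X' :: "'a graph" and \<rho> :: "'a \<Rightarrow> 'b"
    and f :: "int \<Rightarrow> 'b" and x\<^sub>0 :: 'b and x\<^sub>0' :: 'a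
  assumes "looped_graph X" and "x\<^sub>0 \<in> verts X"
    and "covering_graph X' \<rho> X"
    and "graph_hom I_inf X f" and "stable_map f" and "f (start_index f) = x\<^sub>0"
    and "x\<^sub>0' \<in> verts X'" and "\<rho> x\<^sub>0' = x\<^sub>0"
  shows "\<exists>!f'. is_lift I_inf X' \<rho> f f' \<and> starts_at f' x\<^sub>0'"
proof (rule ex_ex1I)
  have "starts_at f x\<^sub>0" using assms(5,6) by (simp add: starts_at_def stable_map_def)
  then obtain n where "\<forall>m\<le>n. f m = \<rho> x\<^sub>0'" using assms(8) by (auto simp: starts_at_iff)
  from lift_exists[OF assms(1,3,4) this assms(7)]
  show "\<exists>f'. is_lift I_inf X' \<rho> f f' \<and> starts_at f' x\<^sub>0'"
    by (auto simp: starts_at_iff)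
next
  fix g h
  assume g: "is_lift I_inf X' \<rho> f g \<and> starts_at g x\<^sub>0'"
    and h: "is_lift I_inf X' \<rho> f h \<and> starts_at h x\<^sub>0'"
  then obtain a b where "\<forall>m\<le>a. g m = x\<^sub>0'" "\<forall>m\<le>b. h m = x\<^sub>0'"
    by (auto simp: starts_at_iff)
  then have "g (min a b) = h (min a b)" by simp
  then show "g = h" using lift_unique[OF assms(1,3,4)] g h by blast
qed

end
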